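(* The binary $3$-cube graph $Q_3$ and each prism $C_{4j}\square K_2$ (with $j\in\mathbb{Z}$, $j>1$) admit two efficient total girth colorings (ETGCs) with color set $\{0,1,2,3\}$ that are mutually orthogonal. Moreover, any two such orthogonal ETGCs yield an edge-girth coloring (EGC) of the corresponding graph $Q_4=Q_3\square K_2$, respectively $(C_{4j}\square K_2)\square K_2$.
   Context: A total coloring (TC) of a graph assigns colors to vertices and edges so that no two adjacent vertices, no two edges sharing an endpoint, and no edge and one of its endpoints get the same color. For a connected $k$-regular simple graph $\Gamma$, a TC with color set $[k+1]=\{0,\dots,k\}$ is an efficient total coloring (ETC) if for every vertex $v$ the vertices of the closed neighborhood $N[v]$ receive pairwise distinct colors (hence all $k+1$ colors), and each color class of vertices is an efficient dominating set (an independent set $S$ such that every vertex outside $S$ has exactly one neighbor in $S$). For a $k$-regular graph of girth $k+1$ (here $k=3$, girth $4$), an efficient total girth coloring (ETGC) is an ETC in which every girth cycle (here every $4$-cycle) has its $k+1$ vertices colored with all $k+1$ colors, each exactly once, and its $k+1$ edges colored with all $k+1$ colors, each exactly once. Two ETCs are orthogonal if they have the same vertex coloring and differ in color on every edge. $C_n$ denotes the $n$-cycle, $K_2$ the complete graph on two vertices, and $\square$ the Cartesian product. For the $4$-regular graphs $Q_4$ and $(C_{4j}\square K_2)\square K_2$, an edge-girth coloring (EGC) means a proper edge coloring with $4$ colors in which every $4$-cycle (girth cycle) receives each of the $4$ colors exactly once. *)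

theory Defs
  imports "HOL-Library.Extended_Nat"
begin

section \<open>Simple graphs\<close>

text \<open>A graph is a pair of a vertex set and a set of edges, every edge being a two-element
  set of vertices.\<close>

type_synonym 'a graph = "'a set \<times> 'a set set"

abbreviation verts :: "'a graph \<Rightarrow> 'a set" where
  "verts G \<equiv> fst G"

abbreviation edges :: "'a graph \<Rightarrow> 'a set set" where
  "edges G \<equiv> snd G"

definition simple_graph :: "'a graph \<Rightarrow> bool" where
  "simple_graph G \<longleftrightarrow> (\<forall>E\<in>edges G. E \<subseteq> verts G \<and> card E = 2)"

definition adjacent :: "'a graph \<Rightarrow> 'a \<Rightarrow> 'a \<Rightarrow> bool" where
  "adjacent G u v \<longleftrightarrow> {u, v} \<in> edges G"

definition nbhd :: "'a graph \<Rightarrow> 'a \<Rightarrow> 'a set" where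
  "nbhd G v = {u. adjacent G v u}"

definition closed_nbhd :: "'a graph \<Rightarrow> 'a \<Rightarrow> 'a set" where
  "closed_nbhd G v = insert v (nbhd G v)"

definition regular_graph :: "nat \<Rightarrow> 'a graph \<Rightarrow> bool" where
  "regular_graph k G \<longleftrightarrow> (\<forall>v\<in>verts G. finite (nbhd G v) \<and> card (nbhd G v) = k)"

definition connected_graph :: "'a graph \<Rightarrow> bool" where
  "connected_graph G \<longleftrightarrow>
     verts G \<noteq> {} \<and> (\<forall>u\<in>verts G. \<forall>v\<in>verts G. (adjacent G)\<^sup>*\<^sup>* u v)"

definition isomorphic :: "'a graph \<Rightarrow> 'b graph \<Rightarrow> bool" where
  "isomorphic G H \<longleftrightarrow>
     (\<exists>\<phi>. bij_betw \<phi> (verts G) (verts H) \<and>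
          (\<forall>u\<in>verts G. \<forall>v\<in>verts G. adjacent G u v \<longleftrightarrow> adjacent H (\<phi> u) (\<phi> v)))"

text \<open>A cycle is given by the cyclic list of its vertices, so that one and the same cycle
  is represented by several lists (rotations and reversals).\<close>

definition is_cycle :: "'a graph \<Rightarrow> 'a list \<Rightarrow> bool" where
  "is_cycle G xs \<longleftrightarrow>
     length xs \<ge> 3 \<and> distinct xs \<and> set xs \<subseteq> verts G \<and>
     (\<forall>i<length xs. adjacent G (xs ! i) (xs ! (Suc i mod length xs)))"

definition cycle_edges :: "'a list \<Rightarrow> 'a set set" where
  "cycle_edges xs = {{xs ! i, xs ! (Suc i mod length xs)} | i. i < length xs}"

text \<open>The girth of an acyclic graph is \<open>\<infinity>\<close>.\<close>

definition girth :: "'a graph \<Rightarrow> enat" where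
  "girth G = (INF xs\<in>{xs. is_cycle G xs}. enat (length xs))"

definition girth_cycle :: "'a graph \<Rightarrow> 'a list \<Rightarrow> bool" where
  "girth_cycle G xs \<longleftrightarrow> is_cycle G xs \<and> enat (length xs) = girth G"


section \<open>The graphs involved\<close>

definition cartesian_product :: "'a graph \<Rightarrow> 'b graph \<Rightarrow> ('a \<times> 'b) graph"
    (infixl "\<box>" 70) where
  "G \<box> H =
     (verts G \<times> verts H,
      {{(u, x), (v, x)} | u v x. {u, v} \<in> edges G \<and> x \<in> verts H} \<union>
      {{(u, x), (u, y)} | u x y. u \<in> verts G \<and> {x, y} \<in> edges H})"

definition complete_graph :: "nat \<Rightarrow> nat graph" where
  "complete_graph n = ({..<n}, {{u, v} | u v. u < n \<and> v < n \<and> u \<noteq> v})"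

text \<open>Meaningful for \<open>n \<ge> 3\<close> only.\<close>

definition cycle_graph :: "nat \<Rightarrow> nat graph" where
  "cycle_graph n = ({..<n}, {{i, Suc i mod n} | i. i < n})"

definition cube_graph :: "nat \<Rightarrow> bool list graph" where
  "cube_graph n =
     ({xs. length xs = n},
      {{xs, ys} | xs ys. length xs = n \<and> length ys = n \<and> card {i. i < n \<and> xs ! i \<noteq> ys ! i} = 1})"


section \<open>Colorings\<close>

definition proper_edge_coloring :: "nat set \<Rightarrow> 'a graph \<Rightarrow> ('a set \<Rightarrow> nat) \<Rightarrow> bool" where
  "proper_edge_coloring C G g \<longleftrightarrow>
     g ` edges G \<subseteq> C \<and>
     (\<forall>E\<in>edges G. \<forall>F\<in>edges G. E \<noteq> F \<and> E \<inter> F \<noteq> {} \<longrightarrow> g E \<noteq> g F)"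

text \<open>A coloring of vertices and edges is a pair of a vertex coloring and an edge coloring;
  only the values on vertices and edges of the graph matter.\<close>

type_synonym 'a tcoloring = "('a \<Rightarrow> nat) \<times> ('a set \<Rightarrow> nat)"

definition total_coloring :: "nat set \<Rightarrow> 'a graph \<Rightarrow> 'a tcoloring \<Rightarrow> bool" where
  "total_coloring C G c \<longleftrightarrow>
     fst c ` verts G \<subseteq> C \<and>
     (\<forall>u\<in>verts G. \<forall>v\<in>verts G. adjacent G u v \<longrightarrow> fst c u \<noteq> fst c v) \<and>
     proper_edge_coloring C G (snd c) \<and>
     (\<forall>E\<in>edges G. \<forall>v\<in>E. snd c E \<noteq> fst c v)"

definition efficient_dominating_set :: "'a graph \<Rightarrow> 'a set \<Rightarrow> bool" where
  "efficient_dominating_set G S \<longleftrightarrow>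
     S \<subseteq> verts G \<and>
     (\<forall>u\<in>S. \<forall>v\<in>S. \<not> adjacent G u v) \<and>
     (\<forall>v\<in>verts G - S. \<exists>!u. u \<in> S \<and> adjacent G v u)"

definition efficient_total_coloring :: "nat \<Rightarrow> 'a graph \<Rightarrow> 'a tcoloring \<Rightarrow> bool" where
  "efficient_total_coloring k G c \<longleftrightarrow>
     simple_graph G \<and> connected_graph G \<and> regular_graph k G \<and>
     total_coloring {0..k} G c \<and>
     (\<forall>v\<in>verts G. inj_on (fst c) (closed_nbhd G v)) \<and>
     (\<forall>a\<in>{0..k}. efficient_dominating_set G {v \<in> verts G. fst c v = a})"

definition efficient_total_girth_coloring :: "nat \<Rightarrow> 'a graph \<Rightarrow> 'a tcoloring \<Rightarrow> bool" where
  "efficient_total_girth_coloring k G c \<longleftrightarrow>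
     efficient_total_coloring k G c \<and> girth G = enat (k + 1) \<and>
     (\<forall>xs. girth_cycle G xs \<longrightarrow>
        bij_betw (fst c) (set xs) {0..k} \<and> bij_betw (snd c) (cycle_edges xs) {0..k})"

definition orthogonal_colorings :: "'a graph \<Rightarrow> 'a tcoloring \<Rightarrow> 'a tcoloring \<Rightarrow> bool" where
  "orthogonal_colorings G c d \<longleftrightarrow>
     (\<forall>v\<in>verts G. fst c v = fst d v) \<and> (\<forall>E\<in>edges G. snd c E \<noteq> snd d E)"

definition edge_girth_coloring :: "nat \<Rightarrow> 'a graph \<Rightarrow> ('a set \<Rightarrow> nat) \<Rightarrow> bool" where
  "edge_girth_coloring k G g \<longleftrightarrow>
     simple_graph G \<and> regular_graph k G \<and> girth G = enat k \<and>
     proper_edge_coloring {0..<k} G g \<and>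
     (\<forall>xs. girth_cycle G xs \<longrightarrow> bij_betw g (cycle_edges xs) {0..<k})"

text \<open>Two colorings \<open>c\<close>, \<open>d\<close> of \<open>G\<close> with the same vertex coloring induce an edge coloring of
  \<open>G \<box> complete_graph 2\<close>: the edges of the copy \<open>G \<times> {0}\<close> are colored by \<open>c\<close>, those of the
  copy \<open>G \<times> {1}\<close> by \<open>d\<close>, and the edge joining \<open>(v, 0)\<close> and \<open>(v, 1)\<close> gets the common color
  of \<open>v\<close>.\<close>

definition layered_edge_coloring ::
    "'a tcoloring \<Rightarrow> 'a tcoloring \<Rightarrow> ('a \<times> nat) set \<Rightarrow> nat" where
  "layered_edge_coloring c d E =
     (if snd ` E = {0} then snd c (fst ` E)
      else if snd ` E = {1} then snd d (fst ` E)
      else fst c (the_elem (fst ` E)))"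

end

theory Submission
  imports Defs
begin

text \<open>In a cubic triangle-free graph the only condition on an efficient total girth coloring that
  is not a condition on single vertex stars is that opposite edges of a 4-cycle differ. Such
  colorings therefore pull back along locally injective homomorphisms. The prism over a cycle of
  length divisible by 4 covers the prism over the 4-cycle, which is the 3-cube, so one orthogonal
  pair on the 3-cube suffices.

  A 4-cycle of \<open>G \<box> K\<^sub>2\<close> outside the two layers consists of an edge \<open>uv\<close>, in both layers, and of the
  rungs at \<open>u\<close> and \<open>v\<close>. Its colours are the two colours of \<open>uv\<close>, which differ by orthogonality, and
  the colours of \<open>u\<close> and \<open>v\<close>, from which they differ by totality.\<close>

section \<open>Adjacency and quadrilaterals\<close>

lemma adjacent_sym: "adjacent G u v \<longleftrightarrow> adjacent G v u"
  by (simp add: adjacent_def insert_commute)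

lemma simple_adjacentD:
  assumes "simple_graph G" "adjacent G u v"
  shows "u \<in> verts G" "v \<in> verts G" "u \<noteq> v"
  using assms unfolding simple_graph_def adjacent_def by fastforce+

lemma simple_not_adjacent_self: "simple_graph G \<Longrightarrow> \<not> adjacent G v v"
  using simple_adjacentD(3) by fast

lemma simple_edgeE:
  assumes "simple_graph G" "E \<in> edges G"
  obtains u v where "E = {u, v}" "adjacent G u v"
  using assms unfolding simple_graph_def adjacent_def by (metis card_2_iff)

definition triangle_free :: "'a graph \<Rightarrow> bool" where
  "triangle_free G \<longleftrightarrow> (\<forall>u v w. adjacent G u v \<longrightarrow> adjacent G v w \<longrightarrow> \<not> adjacent G w u)"

text \<open>Only the two diagonals are required to be proper: in a simple graph adjacent vertices
  differ anyway. This makes a 4-cycle a purely local condition on adjacency, easy to move through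
  maps and products.\<close>

definition quadrilateral :: "'a graph \<Rightarrow> 'a \<Rightarrow> 'a \<Rightarrow> 'a \<Rightarrow> 'a \<Rightarrow> bool" where
  "quadrilateral G p q r s \<longleftrightarrow>
     adjacent G p q \<and> adjacent G q r \<and> adjacent G r s \<and> adjacent G s p \<and> p \<noteq> r \<and> q \<noteq> s"

lemma quadrilateral_rotate: "quadrilateral G p q r s \<Longrightarrow> quadrilateral G q r s p"
  by (auto simp: quadrilateral_def)

lemma is_cycle_3:
  assumes "simple_graph G"
  shows "is_cycle G [u, v, w] \<longleftrightarrow> adjacent G u v \<and> adjacent G v w \<and> adjacent G w u"
proof -
  have "is_cycle G [u, v, w] \<longleftrightarrow> distinct [u, v, w] \<and> {u, v, w} \<subseteq> verts G \<and>
      adjacent G u v \<and> adjacent G v w \<and> adjacent G w u"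
    by (simp add: is_cycle_def All_less_Suc) blast
  then show ?thesis
    using simple_adjacentD[OF assms] by (metis (full_types) distinct_length_2_or_more
        distinct_singleton empty_subsetI insert_subset)
qed

lemma is_cycle_4:
  assumes "simple_graph G"
  shows "is_cycle G [p, q, r, s] \<longleftrightarrow> quadrilateral G p q r s"
proof -
  have "is_cycle G [p, q, r, s] \<longleftrightarrow> distinct [p, q, r, s] \<and> {p, q, r, s} \<subseteq> verts G \<and>
      adjacent G p q \<and> adjacent G q r \<and> adjacent G r s \<and> adjacent G s p"
    by (simp add: is_cycle_def All_less_Suc) blast
  then show ?thesis
    using simple_adjacentD[OF assms] unfolding quadrilateral_def
    by (metis (full_types) distinct_length_2_or_more distinct_singleton empty_subsetI insert_subset)
qed

lemma length_3_eq: "length xs = 3 \<Longrightarrow> \<exists>u v w. xs = [u, v, w]"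
  by (auto simp: numeral_eq_Suc length_Suc_conv)

lemma length_4_eq: "length xs = 4 \<Longrightarrow> \<exists>p q r s. xs = [p, q, r, s]"
  by (auto simp: numeral_eq_Suc length_Suc_conv)

lemma cycle_edges_4: "cycle_edges [p, q, r, s] = {{p, q}, {q, r}, {r, s}, {s, p}}"
proof -
  have len: "length [p, q, r, s] = 4"
    by simp
  have "cycle_edges [p, q, r, s] =
      (\<lambda>i. {[p, q, r, s] ! i, [p, q, r, s] ! (Suc i mod 4)}) ` {i. i < 4}"
    unfolding cycle_edges_def setcompr_eq_image len ..
  also have "{i. i < 4} = {0, 1, 2, 3 :: nat}"
    by auto
  finally show ?thesis
    by simp
qed

lemma girth_eq_4_iff:
  assumes "simple_graph G"
  shows "girth G = enat 4 \<longleftrightarrow> triangle_free G \<and> (\<exists>p q r s. quadrilateral G p q r s)"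
proof
  assume girth: "girth G = enat 4"
  have le: "enat 4 \<le> enat (length xs)" if "is_cycle G xs" for xs
    using that girth by (metis INF_lower girth_def mem_Collect_eq)
  have "triangle_free G"
    unfolding triangle_free_def using le is_cycle_3[OF assms] by fastforce
  moreover have "\<exists>xs. is_cycle G xs \<and> length xs = 4"
  proof -
    let ?L = "(\<lambda>xs. enat (length xs)) ` {xs. is_cycle G xs}"
    have "Inf ?L = enat 4"
      using girth by (simp add: girth_def)
    \<comment> \<open>The infimum of the empty set is \<infinity>, and that of a nonempty set of
      \<open>enat\<close> is its least element; hence the finite value 4 is the length of an actual
      cycle.\<close>
    then have "?L \<noteq> {}" "(LEAST n. n \<in> ?L) = enat 4"
      by (auto simp only: Inf_enat_def split: if_splits)
    then have "enat 4 \<in> ?L"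
      using LeastI_ex[of "\<lambda>n. n \<in> ?L"] by (metis ex_in_conv)
    then show ?thesis
      by auto
  qed
  then obtain p q r s where "is_cycle G [p, q, r, s]"
    using length_4_eq by blast
  ultimately show "triangle_free G \<and> (\<exists>p q r s. quadrilateral G p q r s)"
    using is_cycle_4[OF assms] by blast
next
  assume *: "triangle_free G \<and> (\<exists>p q r s. quadrilateral G p q r s)"
  have "4 \<le> length xs" if "is_cycle G xs" for xs
  proof (rule ccontr)
    assume "\<not> 4 \<le> length xs"
    then have "length xs = 3"
      using that by (auto simp: is_cycle_def)
    then show False
      using that * length_3_eq[of xs] is_cycle_3[OF assms] unfolding triangle_free_def by blast
  qed
  obtain p q r s where "is_cycle G [p, q, r, s]"
    using * is_cycle_4[OF assms] by blast
  then have "girth G \<le> enat (length [p, q, r, s])"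
    unfolding girth_def by (intro INF_lower) simp
  then have "girth G \<le> enat 4"
    by (simp add: numeral_eq_Suc)
  moreover have "enat 4 \<le> girth G"
    unfolding girth_def using \<open>\<And>xs. is_cycle G xs \<Longrightarrow> 4 \<le> length xs\<close>
    by (intro INF_greatest) auto
  ultimately show "girth G = enat 4"
    by (rule antisym)
qed

lemma girth_cycle_4_iff:
  assumes "simple_graph G" "girth G = enat 4"
  shows "girth_cycle G xs \<longleftrightarrow> (\<exists>p q r s. xs = [p, q, r, s] \<and> quadrilateral G p q r s)"
  using assms length_4_eq[of xs] is_cycle_4[OF assms(1)] by (auto simp: girth_cycle_def)

section \<open>Local criteria for girth colorings\<close>

text \<open>Two distinct edges that meet share an end \<open>v\<close> and can be written
  \<open>{v, u}\<close> and \<open>{v, w}\<close>, so properness is a condition on the star of each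
  vertex.\<close>

lemma proper_edge_coloring_iff:
  assumes "simple_graph G"
  shows "proper_edge_coloring C G g \<longleftrightarrow>
    (\<forall>u v. adjacent G u v \<longrightarrow> g {u, v} \<in> C) \<and>
    (\<forall>u v w. adjacent G v u \<longrightarrow> adjacent G v w \<longrightarrow> u \<noteq> w \<longrightarrow> g {v, u} \<noteq> g {v, w})"
    (is "_ \<longleftrightarrow> ?L")
proof
  assume "proper_edge_coloring C G g"
  then show ?L
    unfolding proper_edge_coloring_def adjacent_def by (auto simp: doubleton_eq_iff)
next
  assume L: ?L
  have "g E \<noteq> g F" if EF: "E \<in> edges G" "F \<in> edges G" "E \<noteq> F" "v \<in> E" "v \<in> F" for E F v
  proof -
    have "\<exists>u. D = {v, u} \<and> adjacent G v u" if "D \<in> edges G" "v \<in> D" for D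
      using that by (elim simple_edgeE[OF assms]) (auto simp: adjacent_sym)
    then obtain u w where "E = {v, u}" "adjacent G v u" "F = {v, w}" "adjacent G v w"
      using EF by metis
    then show ?thesis
      using L \<open>E \<noteq> F\<close> by blast
  qed
  moreover have "g E \<in> C" if "E \<in> edges G" for E
    using that L by (metis simple_edgeE[OF assms])
  ultimately show "proper_edge_coloring C G g"
    unfolding proper_edge_coloring_def by blast
qed

lemma bij_betw_4:
  assumes "h a \<noteq> h b" "h a \<noteq> h c" "h a \<noteq> h d" "h b \<noteq> h c" "h b \<noteq> h d" "h c \<noteq> h d"
    and "h ` {a, b, c, d} \<subseteq> {0..3::nat}"
  shows "bij_betw h {a, b, c, d} {0..3}"
proof -
  have inj: "inj_on h {a, b, c, d}"
    using assms(1-6) by (auto simp: inj_on_def)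
  moreover have "card (h ` {a, b, c, d}) = card {0..3::nat}"
    using assms(1-6) by simp
  then have "h ` {a, b, c, d} = {0..3}"
    using assms(7) by (intro card_subset_eq) auto
  ultimately show ?thesis
    by (simp add: bij_betw_def)
qed

text \<open>Consecutive edges share a vertex and are separated by properness. This leaves the two
  opposite pairs, the second of which is the first one of the rotated quadrilateral.\<close>

lemma bij_betw_cycle_edges_4:
  assumes "simple_graph G" "proper_edge_coloring {0..3} G g"
    and opposite: "\<And>p q r s. quadrilateral G p q r s \<Longrightarrow> g {p, q} \<noteq> g {r, s}"
    and quad: "quadrilateral G p q r s"
  shows "bij_betw g (cycle_edges [p, q, r, s]) {0..3}"
proof -
  have adj: "adjacent G p q" "adjacent G q r" "adjacent G r s" "adjacent G s p" "p \<noteq> r" "q \<noteq> s"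
    using quad by (simp_all add: quadrilateral_def)
  have proper: "g {u, v} \<noteq> g {v, w}" if "adjacent G u v" "adjacent G v w" "u \<noteq> w" for u v w
    using that assms(2) unfolding proper_edge_coloring_iff[OF assms(1)]
    by (metis adjacent_sym insert_commute)
  have "g {p, q} \<noteq> g {q, r}" "g {q, r} \<noteq> g {r, s}" "g {r, s} \<noteq> g {s, p}" "g {s, p} \<noteq> g {p, q}"
    using proper adj by (metis, metis, metis, metis)
  moreover have "g {p, q} \<noteq> g {r, s}" "g {q, r} \<noteq> g {s, p}"
    using opposite quad quadrilateral_rotate[OF quad] by auto
  moreover have "g ` {{p, q}, {q, r}, {r, s}, {s, p}} \<subseteq> {0..3}"
    using assms(2) adj unfolding proper_edge_coloring_def adjacent_def by blast
  ultimately show ?thesis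
    unfolding cycle_edges_4 by (intro bij_betw_4) metis+
qed

text \<open>A colour class is efficient because a closed neighbourhood has as many vertices as there
  are colours: injectivity on it already means that every colour occurs there exactly once.\<close>

lemma efficient_total_coloringI:
  assumes "simple_graph G" "connected_graph G" "regular_graph k G" "total_coloring {0..k} G c"
    and inj: "\<And>v. v \<in> verts G \<Longrightarrow> inj_on (fst c) (closed_nbhd G v)"
  shows "efficient_total_coloring k G c"
proof -
  have "efficient_dominating_set G {v \<in> verts G. fst c v = a}" if "a \<in> {0..k}" for a
  proof -
    have "\<exists>!u. u \<in> {v \<in> verts G. fst c v = a} \<and> adjacent G v u"
      if v: "v \<in> verts G" "fst c v \<noteq> a" for v
    proof -
      have sub: "closed_nbhd G v \<subseteq> verts G"
        using v simple_adjacentD[OF assms(1)] by (auto simp: closed_nbhd_def nbhd_def)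
      have "v \<notin> nbhd G v"
        using simple_not_adjacent_self[OF assms(1)] by (simp add: nbhd_def)
      then have "card (closed_nbhd G v) = Suc k"
        using assms(3) v by (simp add: closed_nbhd_def regular_graph_def)
      then have "card (fst c ` closed_nbhd G v) = card {0..k}"
        using card_image[OF inj[OF v(1)]] by simp
      moreover have "fst c ` closed_nbhd G v \<subseteq> {0..k}"
        using sub assms(4) by (auto simp: total_coloring_def)
      ultimately have "fst c ` closed_nbhd G v = {0..k}"
        by (intro card_subset_eq) auto
      then obtain u where "u \<in> closed_nbhd G v" "fst c u = a"
        using \<open>a \<in> {0..k}\<close> by (metis imageE)
      \<comment> \<open>The vertex \<open>u\<close> of colour \<open>a\<close> is not
        \<open>v\<close>, whose colour is different, so it is a neighbour of \<open>v\<close>;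
        injectivity makes it the only one.\<close>
      then show ?thesis
        using v sub inj[OF v(1)]
        by (intro ex1I[of _ u]) (auto simp: closed_nbhd_def nbhd_def inj_on_def)
    qed
    moreover have "\<not> adjacent G u v" if "u \<in> verts G" "v \<in> verts G" "fst c u = fst c v" for u v
      using assms(4) that unfolding total_coloring_def by blast
    ultimately show ?thesis
      unfolding efficient_dominating_set_def by auto
  qed
  then show ?thesis
    using assms unfolding efficient_total_coloring_def by blast
qed

text \<open>On a 4-cycle, neighbouring vertices are separated by totality and diagonal ones because
  they have a common neighbour. The given quadrilateral keeps the girth from exceeding 4.\<close>

lemma efficient_total_girth_coloringI:
  assumes "simple_graph G" "connected_graph G" "regular_graph 3 G"
    and "triangle_free G" "quadrilateral G p q r s"
    and "total_coloring {0..3} G c"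
    and inj: "\<And>u v w. adjacent G v u \<Longrightarrow> adjacent G v w \<Longrightarrow> u \<noteq> w \<Longrightarrow> fst c u \<noteq> fst c w"
    and opposite: "\<And>p q r s. quadrilateral G p q r s \<Longrightarrow> snd c {p, q} \<noteq> snd c {r, s}"
  shows "efficient_total_girth_coloring 3 G c"
proof -
  have adj: "fst c u \<noteq> fst c v" if "adjacent G u v" for u v
    using that assms(6) simple_adjacentD[OF assms(1) that] unfolding total_coloring_def by blast
  have proper: "proper_edge_coloring {0..3} G (snd c)"
    using assms(6) by (simp add: total_coloring_def)
  have "inj_on (fst c) (closed_nbhd G v)" for v
    unfolding inj_on_def closed_nbhd_def nbhd_def using adj inj by (metis insertE mem_Collect_eq)
  then have "efficient_total_coloring 3 G c"
    using assms by (intro efficient_total_coloringI) auto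
  moreover have "girth G = enat 4"
    using assms by (auto simp: girth_eq_4_iff)
  moreover have "bij_betw (fst c) {p, q, r, s} {0..3}" if "quadrilateral G p q r s" for p q r s
  proof -
    have adjs: "adjacent G p q" "adjacent G q r" "adjacent G r s" "adjacent G s p" "p \<noteq> r" "q \<noteq> s"
      using that by (simp_all add: quadrilateral_def)
    have "{p, q, r, s} \<subseteq> verts G"
      using adjs(1-4)[THEN simple_adjacentD(1)[OF assms(1)]] by simp
    then have "fst c ` {p, q, r, s} \<subseteq> {0..3}"
      using assms(6) unfolding total_coloring_def by blast
    moreover have "fst c p \<noteq> fst c r" "fst c q \<noteq> fst c s"
      using inj adjs adjacent_sym by (metis, metis)
    ultimately show ?thesis
      using adjs adj by (intro bij_betw_4) metis+
  qed
  ultimately show ?thesis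
    using bij_betw_cycle_edges_4[OF assms(1) proper opposite] assms(1)
    by (auto simp: efficient_total_girth_coloring_def girth_cycle_4_iff)
qed

lemma edge_girth_coloringI:
  assumes "simple_graph G" "regular_graph 4 G" "triangle_free G" "quadrilateral G p q r s"
    and "proper_edge_coloring {0..3} G g"
    and "\<And>p q r s. quadrilateral G p q r s \<Longrightarrow> g {p, q} \<noteq> g {r, s}"
  shows "edge_girth_coloring 4 G g"
proof -
  have "{0..<4} = {0..3::nat}"
    by auto
  moreover have "girth G = enat 4"
    using assms by (auto simp: girth_eq_4_iff)
  ultimately show ?thesis
    using bij_betw_cycle_edges_4[OF assms(1,5,6)] assms
    by (auto simp: edge_girth_coloring_def girth_cycle_4_iff)
qed

lemma efficient_total_girth_coloring_opposite:
  assumes "efficient_total_girth_coloring 3 G c" "quadrilateral G p q r s"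
  shows "snd c {p, q} \<noteq> snd c {r, s}"
proof -
  have simple: "simple_graph G" and girth: "girth G = enat 4"
    using assms by (auto simp: efficient_total_girth_coloring_def efficient_total_coloring_def)
  have "girth_cycle G [p, q, r, s]"
    using girth_cycle_4_iff[OF simple girth] assms(2) by blast
  then have "inj_on (snd c) {{p, q}, {q, r}, {r, s}, {s, p}}"
    using assms(1) unfolding efficient_total_girth_coloring_def bij_betw_def cycle_edges_4[symmetric]
    by blast
  \<comment> \<open>Injectivity on the set of edges separates colours only once the two edges are
    known to be distinct sets.\<close>
  moreover have "{p, q} \<noteq> {r, s}"
    using assms(2) simple_adjacentD(3)[OF simple]
    by (auto simp: quadrilateral_def doubleton_eq_iff)
  ultimately show ?thesis
    by (auto simp: inj_on_def)
qed

section \<open>Cartesian products\<close>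

lemma verts_cartesian_product [simp]: "verts (G \<box> H) = verts G \<times> verts H"
  by (simp add: cartesian_product_def)

lemma adjacent_cartesian_product:
  "adjacent (G \<box> H) (u, x) (v, y) \<longleftrightarrow>
     x = y \<and> x \<in> verts H \<and> adjacent G u v \<or> u = v \<and> u \<in> verts G \<and> adjacent H x y"
    (is "?L \<longleftrightarrow> ?R")
proof
  show "?L \<Longrightarrow> ?R"
    by (auto simp: adjacent_def cartesian_product_def doubleton_eq_iff insert_commute)
  show "?R \<Longrightarrow> ?L"
    unfolding adjacent_def cartesian_product_def snd_conv by blast
qed

lemma simple_graph_cartesian_product:
  assumes "simple_graph G" "simple_graph H"
  shows "simple_graph (G \<box> H)"
  unfolding simple_graph_def
proof
  fix E assume "E \<in> edges (G \<box> H)"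
  then consider u v x where "E = {(u, x), (v, x)}" "adjacent G u v" "x \<in> verts H"
    | u x y where "E = {(u, x), (u, y)}" "u \<in> verts G" "adjacent H x y"
    unfolding cartesian_product_def adjacent_def snd_conv by blast
  then show "E \<subseteq> verts (G \<box> H) \<and> card E = 2"
  proof cases
    case 1
    then show ?thesis
      using simple_adjacentD[OF assms(1) 1(2)] by simp
  next
    case 2
    then show ?thesis
      using simple_adjacentD[OF assms(2) 2(3)] by simp
  qed
qed

text \<open>The neighbours of \<open>(u, x)\<close> split into those along \<open>G\<close> and
  those along \<open>H\<close>; a common one would make \<open>u\<close> its own neighbour.\<close>

lemma regular_graph_cartesian_product:
  assumes "simple_graph G" "regular_graph k G" "regular_graph l H"
  shows "regular_graph (k + l) (G \<box> H)"
  unfolding regular_graph_def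
proof
  fix z assume "z \<in> verts (G \<box> H)"
  then obtain u x where z: "z = (u, x)" "u \<in> verts G" "x \<in> verts H"
    by auto
  have "nbhd (G \<box> H) z = nbhd G u \<times> {x} \<union> {u} \<times> nbhd H x"
    using z by (auto simp: nbhd_def adjacent_cartesian_product)
  moreover have "u \<notin> nbhd G u"
    using simple_not_adjacent_self[OF assms(1)] by (simp add: nbhd_def)
  then have "nbhd G u \<times> {x} \<inter> {u} \<times> nbhd H x = {}"
    by auto
  ultimately show "finite (nbhd (G \<box> H) z) \<and> card (nbhd (G \<box> H) z) = k + l"
    using assms(2,3) z by (simp add: regular_graph_def card_Un_disjoint card_cartesian_product)
qed

lemma connected_graph_cartesian_product:
  assumes "connected_graph G" "connected_graph H"
  shows "connected_graph (G \<box> H)"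
  unfolding connected_graph_def
proof (intro conjI ballI)
  show "verts (G \<box> H) \<noteq> {}"
    using assms by (auto simp: connected_graph_def)
  fix a b assume "a \<in> verts (G \<box> H)" "b \<in> verts (G \<box> H)"
  then obtain u x v y where ab: "a = (u, x)" "b = (v, y)"
    "u \<in> verts G" "v \<in> verts G" "x \<in> verts H" "y \<in> verts H"
    by auto
  have "(adjacent (G \<box> H))\<^sup>*\<^sup>* (u, x) (v, x)" if "(adjacent G)\<^sup>*\<^sup>* u v"
    using that ab(5)
    by induction (auto intro: rtranclp.rtrancl_into_rtrancl simp: adjacent_cartesian_product)
  moreover have "(adjacent (G \<box> H))\<^sup>*\<^sup>* (v, x) (v, y)" if "(adjacent H)\<^sup>*\<^sup>* x y"
    using that ab(4)
    by induction (auto intro: rtranclp.rtrancl_into_rtrancl simp: adjacent_cartesian_product)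
  ultimately show "(adjacent (G \<box> H))\<^sup>*\<^sup>* a b"
    using assms ab unfolding connected_graph_def by (metis rtranclp_trans)
qed

section \<open>Complete graphs\<close>

lemma verts_complete_graph [simp]: "verts (complete_graph n) = {..<n}"
  by (simp add: complete_graph_def)

lemma adjacent_complete_graph:
  "adjacent (complete_graph n) u v \<longleftrightarrow> u < n \<and> v < n \<and> u \<noteq> v"
  by (auto simp: adjacent_def complete_graph_def doubleton_eq_iff)

lemma simple_graph_complete: "simple_graph (complete_graph n)"
  by (auto simp: simple_graph_def complete_graph_def)

lemma regular_graph_complete: "regular_graph (n - 1) (complete_graph n)"
proof -
  have "nbhd (complete_graph n) v = {..<n} - {v}" if "v < n" for v
    using that by (auto simp: nbhd_def adjacent_complete_graph)
  then show ?thesis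
    by (simp add: regular_graph_def)
qed

lemma connected_graph_complete:
  assumes "n > 0"
  shows "connected_graph (complete_graph n)"
proof -
  have "(adjacent (complete_graph n))\<^sup>*\<^sup>* u v" if "u < n" "v < n" for u v
    using that by (cases "u = v") (auto intro!: r_into_rtranclp simp: adjacent_complete_graph)
  then show ?thesis
    using assms by (auto simp: connected_graph_def)
qed

section \<open>Two orthogonal colorings as layers\<close>

lemma layered_edge_coloring_simps [simp]:
  "layered_edge_coloring c d {(u, 0), (v, 0)} = snd c {u, v}"
  "layered_edge_coloring c d {(u, Suc 0), (v, Suc 0)} = snd d {u, v}"
  "layered_edge_coloring c d {(u, 0), (u, Suc 0)} = fst c u"
  "layered_edge_coloring c d {(u, Suc 0), (u, 0)} = fst c u"
  by (auto simp: layered_edge_coloring_def)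

lemma adjacent_prism:
  "adjacent (G \<box> complete_graph 2) a b \<longleftrightarrow>
     snd a = snd b \<and> snd a \<in> {0, 1} \<and> adjacent G (fst a) (fst b) \<or>
     fst a = fst b \<and> fst a \<in> verts G \<and> (snd a, snd b) \<in> {(0, 1), (1, 0)}"
  by (cases a; cases b) (auto simp: adjacent_cartesian_product adjacent_complete_graph)

text \<open>A closed walk changes layers an even number of times. A triangle without rungs lies in a
  copy of \<open>G\<close>; with two rungs its third edge would project to a loop.\<close>

lemma triangle_free_prism:
  assumes "simple_graph G" "triangle_free G"
  shows "triangle_free (G \<box> complete_graph 2)"
  using assms(2) simple_not_adjacent_self[OF assms(1)]
  unfolding triangle_free_def by (auto simp: adjacent_prism)

lemma layered_edge_girth_coloring:
  assumes c: "efficient_total_girth_coloring 3 G c"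
    and d: "efficient_total_girth_coloring 3 G d"
    and orth: "orthogonal_colorings G c d"
  shows "edge_girth_coloring 4 (G \<box> complete_graph 2) (layered_edge_coloring c d)"
proof -
  let ?P = "G \<box> complete_graph 2" and ?g = "layered_edge_coloring c d"
  have simple: "simple_graph G" and reg: "regular_graph 3 G" and girth: "girth G = enat 4"
    and tc: "total_coloring {0..3} G c" and td: "total_coloring {0..3} G d"
    using c d by (auto simp: efficient_total_girth_coloring_def efficient_total_coloring_def)
  note adjD = simple_adjacentD[OF simple]
  have tf: "triangle_free G"
    using girth girth_eq_4_iff[OF simple] by blast
  obtain p q r s where quad: "quadrilateral G p q r s"
    using girth girth_eq_4_iff[OF simple] by blast
  have simpleP: "simple_graph ?P"
    by (intro simple_graph_cartesian_product simple simple_graph_complete)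
  have same: "fst d v = fst c v" if "v \<in> verts G" for v
    using orth that by (simp add: orthogonal_colorings_def)
  have range: "fst c v \<le> 3" if "v \<in> verts G" for v
    using tc that by (auto simp: total_coloring_def)
  have erange: "snd c {u, v} \<le> 3" "snd d {u, v} \<le> 3" if "adjacent G u v" for u v
    using tc td that by (auto simp: total_coloring_def proper_edge_coloring_iff[OF simple])
  have proper: "snd c {v, u} \<noteq> snd c {v, w}" "snd d {v, u} \<noteq> snd d {v, w}"
    if "adjacent G v u" "adjacent G v w" "u \<noteq> w" for u v w
    using tc td that by (auto simp: total_coloring_def proper_edge_coloring_iff[OF simple])
  have vertex: "fst c u \<noteq> fst c v" if "adjacent G u v" for u v
    using tc that adjD by (auto simp: total_coloring_def)
  \<comment> \<open>The rungs are coloured by \<open>c\<close>, so the layer coloured by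
    \<open>d\<close> avoids their colours only because both colorings agree on vertices.\<close>
  have incident: "snd c {u, v} \<noteq> fst c u" "snd d {u, v} \<noteq> fst c u" if "adjacent G u v" for u v
    using tc td that adjD same unfolding total_coloring_def adjacent_def
    by (metis insertI1, metis insertI1)
  have layers: "snd c {u, v} \<noteq> snd d {u, v}" if "adjacent G u v" for u v
    using orth that by (auto simp: orthogonal_colorings_def adjacent_def)
  have "regular_graph (3 + (2 - 1)) ?P"
    by (intro regular_graph_cartesian_product simple reg regular_graph_complete)
  then have "regular_graph 4 ?P"
    by simp
  moreover have "triangle_free ?P"
    by (rule triangle_free_prism[OF simple tf])
  moreover have "quadrilateral ?P (p, 0) (q, 0) (r, 0) (s, 0)"
    using quad by (simp add: quadrilateral_def adjacent_prism)
  moreover have "proper_edge_coloring {0..3} ?P ?g"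
    unfolding proper_edge_coloring_iff[OF simpleP]
  proof (intro conjI allI impI)
    fix a b assume "adjacent ?P a b"
    then show "?g {a, b} \<in> {0..3}"
      by (cases a; cases b) (auto simp: adjacent_prism range erange)
  next
    fix u v w assume "adjacent ?P v u" "adjacent ?P v w" "u \<noteq> w"
    \<comment> \<open>Two edges at a vertex lie in the same layer, where \<open>proper\<close>
      applies, or one is the rung, where \<open>incident\<close> applies.\<close>
    then show "?g {v, u} \<noteq> ?g {v, w}"
      using proper incident incident[symmetric]
      by (cases u; cases v; cases w) (auto simp: adjacent_prism)
  qed
  moreover have "?g {p, q} \<noteq> ?g {r, s}" if "quadrilateral ?P p q r s" for p q r s
  proof -
    obtain p' x q' y r' z s' t where pqrs: "p = (p', x)" "q = (q', y)" "r = (r', z)" "s = (s', t)"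
      by (metis surj_pair)
    have opp: "snd c {p', q'} \<noteq> snd c {r', s'}" "snd d {p', q'} \<noteq> snd d {r', s'}"
      if "adjacent G p' q'" "adjacent G q' r'" "adjacent G r' s'" "adjacent G s' p'"
        "p' \<noteq> r'" "q' \<noteq> s'"
      using efficient_total_girth_coloring_opposite[OF c]
        efficient_total_girth_coloring_opposite[OF d] that
      by (auto simp: quadrilateral_def)
    \<comment> \<open>A quadrilateral has no rungs or two opposite ones, since two consecutive rungs
      would make a diagonal degenerate. The opposite edges compared are thus in one layer
      (\<open>opp\<close>), copies of one edge in both layers (\<open>layers\<close>), or rungs over
      adjacent vertices (\<open>vertex\<close>).\<close>
    show ?thesis
      using that opp vertex layers layers[symmetric] simple_not_adjacent_self[OF simple]
      unfolding pqrs quadrilateral_def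
      by (auto simp: adjacent_prism insert_commute)
  qed
  ultimately show ?thesis
    using simpleP by (intro edge_girth_coloringI)
qed

section \<open>Hypercubes\<close>

lemma verts_cube_graph [simp]: "verts (cube_graph n) = {xs. length xs = n}"
  by (simp add: cube_graph_def)

lemma adjacent_cube_graph:
  "adjacent (cube_graph n) xs ys \<longleftrightarrow>
     length xs = n \<and> length ys = n \<and> card {i. i < n \<and> xs ! i \<noteq> ys ! i} = 1"
proof -
  have "{i. i < n \<and> xs ! i \<noteq> ys ! i} = {i. i < n \<and> ys ! i \<noteq> xs ! i}" for xs ys :: "bool list"
    by auto
  then show ?thesis
    by (auto simp: adjacent_def cube_graph_def doubleton_eq_iff)
qed

text \<open>Splitting the first coordinate off the Hamming distance makes adjacency in the cube
  recursive in the dimension.\<close>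

lemma card_differences_Cons:
  "card {i. i < Suc n \<and> (x # xs) ! i \<noteq> (y # ys) ! i} =
     of_bool (x \<noteq> y) + card {i. i < n \<and> xs ! i \<noteq> ys ! i}"
proof -
  have "{i. i < Suc n \<and> (x # xs) ! i \<noteq> (y # ys) ! i} =
      (if x \<noteq> y then {0} else {}) \<union> Suc ` {i. i < n \<and> xs ! i \<noteq> ys ! i}"
    by (auto simp: less_Suc_eq_0_disj)
  then show ?thesis
    by (auto simp: card_image card_insert_if)
qed

lemma adjacent_cube_graph_0: "\<not> adjacent (cube_graph 0) xs ys"
  by (simp add: adjacent_cube_graph)

lemma adjacent_cube_graph_Suc:
  "adjacent (cube_graph (Suc n)) (x # xs) (y # ys) \<longleftrightarrow>
     x \<noteq> y \<and> length xs = n \<and> xs = ys \<or> x = y \<and> adjacent (cube_graph n) xs ys"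
proof -
  define d where "d = card {i. i < n \<and> xs ! i \<noteq> ys ! i}"
  have "d = 0 \<longleftrightarrow> xs = ys" if "length xs = n" "length ys = n"
    using that by (auto simp: d_def intro: nth_equalityI)
  moreover have "adjacent (cube_graph n) xs ys \<longleftrightarrow> length xs = n \<and> length ys = n \<and> d = 1"
    by (simp only: adjacent_cube_graph d_def)
  ultimately show ?thesis
    unfolding adjacent_cube_graph[of "Suc n"] card_differences_Cons d_def[symmetric] by auto
qed

text \<open>The layer index becomes the head of the bit list, matching the recursion of
  \<open>adjacent_cube_graph_Suc\<close>.\<close>

lemma cube_graph_Suc_isomorphic: "isomorphic (cube_graph n \<box> complete_graph 2) (cube_graph (Suc n))"
  unfolding isomorphic_def
proof (intro exI conjI)
  let ?\<phi> = "\<lambda>(xs, x). (x = 1) # xs"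
  show "bij_betw ?\<phi> (verts (cube_graph n \<box> complete_graph 2)) (verts (cube_graph (Suc n)))"
    by (rule bij_betw_byWitness[where f' = "\<lambda>ys. (tl ys, of_bool (hd ys))"])
      (auto simp: length_Suc_conv)
  show "\<forall>u\<in>verts (cube_graph n \<box> complete_graph 2). \<forall>v\<in>verts (cube_graph n \<box> complete_graph 2).
      adjacent (cube_graph n \<box> complete_graph 2) u v \<longleftrightarrow>
      adjacent (cube_graph (Suc n)) (?\<phi> u) (?\<phi> v)"
    by (auto simp: adjacent_cube_graph_Suc adjacent_prism)
qed

section \<open>The 3-cube with explicit vertices\<close>

lemma cube_vertex_3:
  assumes "length v = 3"
  obtains x y z where "v = [x, y, z]"
  using assms length_3_eq by metis

lemma adjacent_cube_graph_3:
  "adjacent (cube_graph 3) [x, y, z] v \<longleftrightarrow>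
     v = [\<not> x, y, z] \<or> v = [x, \<not> y, z] \<or> v = [x, y, \<not> z]"
proof (cases "length v = 3")
  case True
  then obtain x' y' z' where "v = [x', y', z']"
    by (rule cube_vertex_3)
  then show ?thesis
    by (auto simp: numeral_3_eq_3 adjacent_cube_graph_Suc adjacent_cube_graph_0)
qed (auto simp: adjacent_cube_graph)

lemma simple_graph_cube: "simple_graph (cube_graph n)"
  unfolding simple_graph_def
proof
  fix E assume "E \<in> edges (cube_graph n)"
  then obtain xs ys where E: "E = {xs, ys}" "length xs = n" "length ys = n"
    and 1: "card {i. i < n \<and> xs ! i \<noteq> ys ! i} = 1"
    unfolding cube_graph_def by auto
  have "xs \<noteq> ys"
    using 1 by auto
  with E show "E \<subseteq> verts (cube_graph n) \<and> card E = 2"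
    by simp
qed

lemma regular_graph_cube_3: "regular_graph 3 (cube_graph 3)"
proof -
  have "nbhd (cube_graph 3) [x, y, z] = {[\<not> x, y, z], [x, \<not> y, z], [x, y, \<not> z]}" for x y z
    by (auto simp: nbhd_def adjacent_cube_graph_3)
  then have "finite (nbhd (cube_graph 3) [x, y, z]) \<and> card (nbhd (cube_graph 3) [x, y, z]) = 3" for x y z
    by simp
  then show ?thesis
    unfolding regular_graph_def by (auto dest!: length_3_eq)
qed

lemma connected_graph_cube_3: "connected_graph (cube_graph 3)"
proof -
  let ?R = "(adjacent (cube_graph 3))\<^sup>*\<^sup>*"
  have "?R [x, y, z] [x', y, z]" for x y z x'
    by (cases x; cases x'; auto simp: adjacent_cube_graph_3)
  moreover have "?R [x, y, z] [x, y', z]" for x y z y'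
    by (cases y; cases y'; auto simp: adjacent_cube_graph_3)
  moreover have "?R [x, y, z] [x, y, z']" for x y z z'
    by (cases z; cases z'; auto simp: adjacent_cube_graph_3)
  ultimately have "?R [x, y, z] [x', y', z']" for x y z x' y' z'
    by (meson rtranclp_trans)
  then show ?thesis
    unfolding connected_graph_def by (auto dest!: length_3_eq intro: exI[of _ "[True, True, True]"])
qed

lemma triangle_free_cube_3: "triangle_free (cube_graph 3)"
  unfolding triangle_free_def
proof (intro allI impI notI)
  fix u v w
  assume *: "adjacent (cube_graph 3) u v" "adjacent (cube_graph 3) v w" "adjacent (cube_graph 3) w u"
  then obtain x y z where "u = [x, y, z]"
    by (meson adjacent_cube_graph cube_vertex_3)
  with * show False
    by (cases x; cases y; cases z) (auto simp: adjacent_cube_graph_3)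
qed

section \<open>Colorings of the 3-cube over the field with four elements\<close>

text \<open>The colour \<open>m + 2 n\<close> stands for the element \<open>m + n \<omega>\<close> of \<open>GF(4)\<close>. The vertex
  \<open>[x, y, z]\<close> has colour \<open>(x + z) + (y + z) \<omega>\<close>, so that its three neighbours are reached by
  adding \<open>1\<close>, \<open>\<omega>\<close> and \<open>\<omega>\<^sup>2\<close>. An edge joining an even vertex of colour \<open>a\<close> with an odd vertex of
  colour \<open>b\<close> gets \<open>\<omega>\<^sup>2 a + \<omega> b\<close> in one coloring and \<open>\<omega> a + \<omega>\<^sup>2 b\<close> in the other; these are the two
  elements of \<open>GF(4)\<close> other than \<open>a\<close> and \<open>b\<close>.\<close>

definition gf4 :: "bool \<Rightarrow> bool \<Rightarrow> nat" where
  "gf4 a b = of_bool a + 2 * of_bool b"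

definition cube_vertex_coloring :: "bool list \<Rightarrow> nat" where
  "cube_vertex_coloring v = gf4 (v ! 0 \<noteq> v ! 2) (v ! 1 \<noteq> v ! 2)"

text \<open>The two coordinates of \<open>\<omega>\<^sup>2 a\<close> or \<open>\<omega> a\<close>, where \<open>a\<close> is the colour of the vertex and \<open>t\<close>
  exchanges the roles of even and odd vertices.\<close>

definition cube_weight0 :: "bool \<Rightarrow> bool list \<Rightarrow> bool" where
  "cube_weight0 t v \<longleftrightarrow>
     (if t = ((v ! 0 \<noteq> v ! 1) \<noteq> v ! 2) then v ! 0 \<noteq> v ! 1 else v ! 1 \<noteq> v ! 2)"

definition cube_weight1 :: "bool \<Rightarrow> bool list \<Rightarrow> bool" where
  "cube_weight1 t v \<longleftrightarrow>
     (if t = ((v ! 0 \<noteq> v ! 1) \<noteq> v ! 2) then v ! 0 \<noteq> v ! 2 else v ! 0 \<noteq> v ! 1)"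

text \<open>An edge is an unordered pair, so the sum of the weights of its two ends is taken
  coordinatewise as the parity of the number of ends where the coordinate is set.\<close>

definition cube_edge_coloring :: "bool \<Rightarrow> bool list set \<Rightarrow> nat" where
  "cube_edge_coloring t E =
     gf4 (odd (card {v \<in> E. cube_weight0 t v})) (odd (card {v \<in> E. cube_weight1 t v}))"

definition cube_coloring :: "bool \<Rightarrow> bool list tcoloring" where
  "cube_coloring t = (cube_vertex_coloring, cube_edge_coloring t)"

lemma gf4_inject [simp]: "gf4 a b = gf4 a' b' \<longleftrightarrow> a = a' \<and> b = b'"
  by (auto simp: gf4_def)

lemma gf4_le: "gf4 a b \<le> 3"
  by (simp add: gf4_def)

lemma odd_card_filter_doubleton:
  assumes "u \<noteq> v"
  shows "odd (card {w \<in> {u, v}. P w}) \<longleftrightarrow> P u \<noteq> P v"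
proof -
  have "{w \<in> {u, v}. P w} = (if P u then {u} else {}) \<union> (if P v then {v} else {})"
    by auto
  then show ?thesis
    using assms by auto
qed

lemma cube_edge_coloring_doubleton:
  assumes "adjacent (cube_graph 3) u v"
  shows "cube_edge_coloring t {u, v} =
    gf4 (cube_weight0 t u \<noteq> cube_weight0 t v) (cube_weight1 t u \<noteq> cube_weight1 t v)"
  unfolding cube_edge_coloring_def
    odd_card_filter_doubleton[OF simple_adjacentD(3)[OF simple_graph_cube assms]] ..

text \<open>Flipping a coordinate adds \<open>1\<close>, \<open>\<omega>\<close> or
  \<open>\<omega>\<^sup>2\<close> to the colour, so the three neighbours of \<open>v\<close> differ
  in colour from \<open>v\<close> and from each other. The disjunction covers both
  comparisons.\<close>

lemma cube_vertex_coloring_neq: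
  assumes "adjacent (cube_graph 3) v u" "w = v \<or> adjacent (cube_graph 3) v w" "u \<noteq> w"
  shows "cube_vertex_coloring u \<noteq> cube_vertex_coloring w"
proof -
  obtain x y z where v: "v = [x, y, z]"
    using assms(1) by (meson adjacent_cube_graph cube_vertex_3)
  show ?thesis
    using assms unfolding v adjacent_cube_graph_3
    by (elim disjE; cases x; cases y; cases z; simp add: cube_vertex_coloring_def)
qed

text \<open>In \<open>GF(4)\<close>, \<open>\<omega>\<^sup>2 a + \<omega> b\<close> equals
  \<open>a\<close> or \<open>b\<close> only if \<open>a = b\<close>, and likewise with
  \<open>\<omega>\<close> and \<open>\<omega>\<^sup>2\<close> exchanged; the ends of an edge have
  different colours.\<close>

lemma cube_edge_coloring_incident:
  assumes "adjacent (cube_graph 3) u v"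
  shows "cube_edge_coloring t {u, v} \<noteq> cube_vertex_coloring u"
proof -
  obtain x y z where u: "u = [x, y, z]"
    using assms by (meson adjacent_cube_graph cube_vertex_3)
  show ?thesis
    using assms unfolding cube_edge_coloring_doubleton[OF assms]
    unfolding u adjacent_cube_graph_3
    by (elim disjE; cases x; cases y; cases z; cases t;
        simp add: cube_vertex_coloring_def cube_weight0_def cube_weight1_def)
qed

text \<open>With \<open>v\<close> fixed, the edge colour is an injective affine function of the
  colour at the other end, and the neighbours of \<open>v\<close> have different colours.\<close>

lemma cube_edge_coloring_proper:
  assumes "adjacent (cube_graph 3) v u" "adjacent (cube_graph 3) v w" "u \<noteq> w"
  shows "cube_edge_coloring t {v, u} \<noteq> cube_edge_coloring t {v, w}"
proof -
  obtain x y z where v: "v = [x, y, z]"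
    using assms(1) by (meson adjacent_cube_graph cube_vertex_3)
  show ?thesis
    using assms unfolding assms(1,2)[THEN cube_edge_coloring_doubleton]
    unfolding v adjacent_cube_graph_3
    by (elim disjE; cases x; cases y; cases z; cases t;
        simp add: cube_weight0_def cube_weight1_def)
qed

text \<open>The walk from \<open>[x, y, z]\<close> through \<open>q\<close> to \<open>r\<close>
  flips two different coordinates, in one of six orders; this bounds the case check for opposite
  edges.\<close>

lemma quadrilateral_cube_3:
  assumes "quadrilateral (cube_graph 3) [x, y, z] q r s"
  shows "(q, r) \<in>
    {([\<not> x, y, z], [\<not> x, \<not> y, z]), ([\<not> x, y, z], [\<not> x, y, \<not> z]),
     ([x, \<not> y, z], [\<not> x, \<not> y, z]), ([x, \<not> y, z], [x, \<not> y, \<not> z]),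
     ([x, y, \<not> z], [\<not> x, y, \<not> z]), ([x, y, \<not> z], [x, \<not> y, \<not> z])}"
proof -
  have "q = [\<not> x, y, z] \<or> q = [x, \<not> y, z] \<or> q = [x, y, \<not> z]"
    and "adjacent (cube_graph 3) q r" "r \<noteq> [x, y, z]"
    using assms by (auto simp: quadrilateral_def adjacent_cube_graph_3)
  then show ?thesis
    by (elim disjE) (auto simp: adjacent_cube_graph_3)
qed

text \<open>Opposite edges flip the same coordinate and so add the same \<alpha>. Since
  \<open>\<omega> + \<omega>\<^sup>2 = 1\<close>, their colours are those of \<open>p\<close> and of
  \<open>r\<close> plus the same multiple of \<alpha>, and \<open>p\<close> and \<open>r\<close>
  differ in colour as neighbours of \<open>q\<close>.\<close>

lemma cube_edge_coloring_opposite: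
  assumes "quadrilateral (cube_graph 3) p q r s"
  shows "cube_edge_coloring t {p, q} \<noteq> cube_edge_coloring t {r, s}"
proof -
  have adj: "adjacent (cube_graph 3) p q" "adjacent (cube_graph 3) r s" "q \<noteq> s"
    "adjacent (cube_graph 3) p s"
    using assms by (auto simp: quadrilateral_def adjacent_sym)
  obtain x y z where p: "p = [x, y, z]"
    using adj(1) by (meson adjacent_cube_graph cube_vertex_3)
  consider "q = [\<not> x, y, z]" "r = [\<not> x, \<not> y, z]" | "q = [\<not> x, y, z]" "r = [\<not> x, y, \<not> z]"
    | "q = [x, \<not> y, z]" "r = [\<not> x, \<not> y, z]" | "q = [x, \<not> y, z]" "r = [x, \<not> y, \<not> z]"
    | "q = [x, y, \<not> z]" "r = [\<not> x, y, \<not> z]" | "q = [x, y, \<not> z]" "r = [x, \<not> y, \<not> z]"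
    using quadrilateral_cube_3[OF assms[unfolded p]] by blast
  then show ?thesis
    using adj(2-4) unfolding adj(1,2)[THEN cube_edge_coloring_doubleton]
    unfolding p adjacent_cube_graph_3
    by cases (elim disjE; cases x; cases y; cases z; cases t;
        simp add: adjacent_cube_graph_3 cube_weight0_def cube_weight1_def)+
qed

text \<open>The two colours of an edge add up to
  \<open>(\<omega>\<^sup>2 + \<omega>) (a + b) = a + b\<close>, which is nonzero because its ends
  have different colours.\<close>

lemma cube_edge_colorings_differ:
  assumes "adjacent (cube_graph 3) u v"
  shows "cube_edge_coloring False {u, v} \<noteq> cube_edge_coloring True {u, v}"
proof -
  obtain x y z where u: "u = [x, y, z]"
    using assms by (meson adjacent_cube_graph cube_vertex_3)
  show ?thesis
    using assms unfolding cube_edge_coloring_doubleton[OF assms]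
    unfolding u adjacent_cube_graph_3
    by (elim disjE; cases x; cases y; cases z; simp add: cube_weight0_def cube_weight1_def)
qed

lemma cube_coloring_etgc: "efficient_total_girth_coloring 3 (cube_graph 3) (cube_coloring t)"
proof (rule efficient_total_girth_coloringI)
  let ?G = "cube_graph 3"
  show "quadrilateral ?G [False, False, False] [True, False, False]
      [True, True, False] [False, True, False]"
    by (simp add: quadrilateral_def adjacent_cube_graph_3)
  have "cube_edge_coloring t E \<noteq> cube_vertex_coloring v" if "E \<in> edges ?G" "v \<in> E" for E v
    using that cube_edge_coloring_incident
    by (elim simple_edgeE[OF simple_graph_cube]) (metis adjacent_sym insert_commute insertE singletonD)
  moreover have "cube_vertex_coloring u \<noteq> cube_vertex_coloring v" if "adjacent ?G u v" for u v
    using cube_vertex_coloring_neq[of v u v] simple_adjacentD(3)[OF simple_graph_cube that] that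
    by (simp add: adjacent_sym)
  moreover have "cube_vertex_coloring v \<in> {0..3}" "cube_edge_coloring t E \<in> {0..3}" for v E
    by (simp_all add: cube_vertex_coloring_def cube_edge_coloring_def gf4_le)
  ultimately show "total_coloring {0..3} ?G (cube_coloring t)"
    using cube_edge_coloring_proper
    unfolding total_coloring_def proper_edge_coloring_iff[OF simple_graph_cube]
      cube_coloring_def fst_conv snd_conv by blast
qed (auto simp: cube_coloring_def simple_graph_cube connected_graph_cube_3 regular_graph_cube_3
    triangle_free_cube_3 cube_vertex_coloring_neq cube_edge_coloring_opposite)

lemma cube_colorings_orthogonal:
  "orthogonal_colorings (cube_graph 3) (cube_coloring False) (cube_coloring True)"
  using cube_edge_colorings_differ unfolding orthogonal_colorings_def cube_coloring_def
  by (metis fst_conv simple_edgeE simple_graph_cube snd_conv)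

section \<open>Pulling back colorings along coverings\<close>

definition pullback_coloring :: "('a \<Rightarrow> 'b) \<Rightarrow> 'b tcoloring \<Rightarrow> 'a tcoloring" where
  "pullback_coloring \<psi> c = (fst c \<circ> \<psi>, \<lambda>E. snd c (\<psi> ` E))"

text \<open>Between cubic graphs, injectivity on neighbourhoods amounts to bijectivity there, so
  this is the local condition for a covering.\<close>

definition locally_injective_hom :: "'a graph \<Rightarrow> 'b graph \<Rightarrow> ('a \<Rightarrow> 'b) \<Rightarrow> bool" where
  "locally_injective_hom G H \<psi> \<longleftrightarrow>
     \<psi> ` verts G \<subseteq> verts H \<and>
     (\<forall>u v. adjacent G u v \<longrightarrow> adjacent H (\<psi> u) (\<psi> v)) \<and>
     (\<forall>u v w. adjacent G v u \<longrightarrow> adjacent G v w \<longrightarrow> \<psi> u = \<psi> w \<longrightarrow> u = w)"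

text \<open>Triangles map to triangles, and quadrilaterals to quadrilaterals because the ends of a
  diagonal share a neighbour. A covering may unroll all 4-cycles, so one in \<open>G\<close> is
  assumed.\<close>

lemma pullback_etgc:
  assumes G: "simple_graph G" "connected_graph G" "regular_graph 3 G" "quadrilateral G p q r s"
    and \<psi>: "locally_injective_hom G H \<psi>"
    and c: "efficient_total_girth_coloring 3 H c"
  shows "efficient_total_girth_coloring 3 G (pullback_coloring \<psi> c)"
proof -
  have H: "simple_graph H" and tc: "total_coloring {0..3} H c" and girth: "girth H = enat 4"
    and inj: "\<And>v. v \<in> verts H \<Longrightarrow> inj_on (fst c) (closed_nbhd H v)"
    using c by (auto simp: efficient_total_girth_coloring_def efficient_total_coloring_def)
  have vert: "\<psi> v \<in> verts H" if "v \<in> verts G" for v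
    using \<psi> that by (auto simp: locally_injective_hom_def)
  have hom: "adjacent H (\<psi> u) (\<psi> v)" if "adjacent G u v" for u v
    using \<psi> that by (auto simp: locally_injective_hom_def)
  have neq: "\<psi> u \<noteq> \<psi> w" if "adjacent G v u" "adjacent G v w" "u \<noteq> w" for u v w
    using \<psi> that unfolding locally_injective_hom_def by blast
  have quad: "quadrilateral H (\<psi> p) (\<psi> q) (\<psi> r) (\<psi> s)" if "quadrilateral G p q r s" for p q r s
    using that hom neq adjacent_sym unfolding quadrilateral_def by metis
  have "triangle_free G"
    using girth hom girth_eq_4_iff[OF H] unfolding triangle_free_def by blast
  moreover have "total_coloring {0..3} G (pullback_coloring \<psi> c)"
    unfolding total_coloring_def
  proof (intro conjI ballI impI)
    show "fst (pullback_coloring \<psi> c) ` verts G \<subseteq> {0..3}"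
      using tc vert unfolding total_coloring_def pullback_coloring_def by fastforce
    show "fst (pullback_coloring \<psi> c) u \<noteq> fst (pullback_coloring \<psi> c) v" if "adjacent G u v" for u v
      using tc hom[OF that] simple_adjacentD[OF H hom[OF that]]
      by (auto simp: total_coloring_def pullback_coloring_def)
    show "proper_edge_coloring {0..3} G (snd (pullback_coloring \<psi> c))"
      using tc hom neq
      by (auto simp: total_coloring_def proper_edge_coloring_iff[OF H]
          proper_edge_coloring_iff[OF G(1)] pullback_coloring_def)
    show "snd (pullback_coloring \<psi> c) E \<noteq> fst (pullback_coloring \<psi> c) v" if "E \<in> edges G" "v \<in> E" for E v
    proof -
      have "\<psi> ` E \<in> edges H"
        using that(1) hom by (elim simple_edgeE[OF G(1)]) (auto simp: adjacent_def)
      then show ?thesis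
        using tc that by (auto simp: total_coloring_def pullback_coloring_def)
    qed
  qed
  moreover have "fst (pullback_coloring \<psi> c) u \<noteq> fst (pullback_coloring \<psi> c) w"
    if "adjacent G v u" "adjacent G v w" "u \<noteq> w" for u v w
    using inj[OF simple_adjacentD(1)[OF H hom[OF that(1)]]] neq[OF that] hom[OF that(1)]
      hom[OF that(2)]
    by (auto simp: pullback_coloring_def inj_on_def closed_nbhd_def nbhd_def)
  moreover have "snd (pullback_coloring \<psi> c) {p, q} \<noteq> snd (pullback_coloring \<psi> c) {r, s}"
    if "quadrilateral G p q r s" for p q r s
    using efficient_total_girth_coloring_opposite[OF c quad[OF that]]
    by (simp add: pullback_coloring_def)
  ultimately show ?thesis
    using G by (intro efficient_total_girth_coloringI)
qed

lemma pullback_orthogonal: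
  assumes "simple_graph G" "locally_injective_hom G H \<psi>" "orthogonal_colorings H c d"
  shows "orthogonal_colorings G (pullback_coloring \<psi> c) (pullback_coloring \<psi> d)"
proof -
  have "\<psi> ` E \<in> edges H" if "E \<in> edges G" for E
    using that assms(2)
    by (elim simple_edgeE[OF assms(1)]) (auto simp: adjacent_def locally_injective_hom_def)
  then show ?thesis
    using assms(2,3)
    by (auto simp: orthogonal_colorings_def pullback_coloring_def locally_injective_hom_def)
qed

section \<open>Prisms over cycles\<close>

lemma verts_cycle_graph [simp]: "verts (cycle_graph n) = {..<n}"
  by (simp add: cycle_graph_def)

lemma adjacent_cycle_graph:
  "adjacent (cycle_graph n) u v \<longleftrightarrow> u < n \<and> v < n \<and> (v = Suc u mod n \<or> u = Suc v mod n)"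
  by (auto simp: adjacent_def cycle_graph_def doubleton_eq_iff)

lemma Suc_mod_neq:
  assumes "n \<ge> 2" "u < n"
  shows "Suc u mod n \<noteq> u"
  using assms by (auto simp: mod_Suc)

lemma simple_graph_cycle:
  assumes "n \<ge> 2"
  shows "simple_graph (cycle_graph n)"
  using assms Suc_mod_neq[OF assms]
  by (auto simp: simple_graph_def cycle_graph_def card_2_iff)

lemma Suc_mod_inj:
  assumes "u < n" "v < n" "Suc u mod n = Suc v mod n"
  shows "u = v"
  using assms by (auto simp: mod_Suc split: if_splits)

lemma regular_graph_cycle:
  assumes "n \<ge> 3"
  shows "regular_graph 2 (cycle_graph n)"
  unfolding regular_graph_def
proof
  fix u assume "u \<in> verts (cycle_graph n)"
  then have u: "u < n"
    by simp
  \<comment> \<open>The predecessor of \<open>u\<close> on the cycle, wrapping around at 0; it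
    differs from the successor because \<open>n\<close> is at least 3.\<close>
  define w where "w = (if u = 0 then n - 1 else u - 1)"
  have w: "w < n" "Suc w mod n = u" "w \<noteq> Suc u mod n"
    using u assms by (auto simp: w_def mod_Suc)
  have "nbhd (cycle_graph n) u = {Suc u mod n, w}"
    using u w(1,2) Suc_mod_inj by (auto simp: nbhd_def adjacent_cycle_graph)
  then show "finite (nbhd (cycle_graph n) u) \<and> card (nbhd (cycle_graph n) u) = 2"
    using w(3) by simp
qed

lemma connected_graph_cycle:
  assumes "n > 0"
  shows "connected_graph (cycle_graph n)"
proof -
  have up: "(adjacent (cycle_graph n))\<^sup>*\<^sup>* 0 u" if "u < n" for u
    using that
    by (induction u) (auto intro: rtranclp.rtrancl_into_rtrancl simp: adjacent_cycle_graph)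
  have "symp (adjacent (cycle_graph n))"
    by (simp add: adjacent_sym sympI)
  then have "(adjacent (cycle_graph n))\<^sup>*\<^sup>* u 0" if "u < n" for u
    using up[OF that] by (metis symp_rtranclp sympD)
  then show ?thesis
    using assms up unfolding connected_graph_def by (auto intro: rtranclp_trans)
qed

text \<open>The prism covers the 3-cube: reduction modulo 4 maps the cycle onto the 4-cycle, whose
  vertices \<open>0, 1, 2, 3\<close> become the Gray code \<open>00, 01, 11, 10\<close>.\<close>

definition prism_cover :: "nat \<times> nat \<Rightarrow> bool list" where
  "prism_cover = (\<lambda>(i, x). [i mod 4 \<in> {2, 3}, i mod 4 \<in> {1, 2}, x = 1])"

lemma prism_cover_locally_injective_hom:
  assumes "4 dvd n"
  shows "locally_injective_hom (cycle_graph n \<box> complete_graph 2) (cube_graph 3) prism_cover"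
proof -
  have mod4: "u mod 4 = 0 \<or> u mod 4 = 1 \<or> u mod 4 = 2 \<or> u mod 4 = 3" for u :: nat
    by arith
  \<comment> \<open>Here divisibility by 4 enters: reduction modulo 4 commutes with the wrap-around
    modulo \<open>n\<close>.\<close>
  have Suc4: "(Suc u mod n) mod 4 = (if u mod 4 = 3 then 0 else Suc (u mod 4))" for u
    using assms by (simp add: mod_mod_cancel mod_Suc[of u 4])
  have up: "adjacent (cube_graph 3) (prism_cover (u, x)) (prism_cover (Suc u mod n, x))" for u x
    using mod4[of u] Suc4[of u]
    by (elim disjE) (simp_all add: prism_cover_def adjacent_cube_graph_3)
  have rung: "adjacent (cube_graph 3) (prism_cover (u, 0)) (prism_cover (u, Suc 0))" for u
    by (simp add: prism_cover_def adjacent_cube_graph_3)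
  \<comment> \<open>The Gray code is injective on residues modulo 4.\<close>
  have fibre: "u mod 4 = v mod 4 \<and> (x = 1 \<longleftrightarrow> y = 1)"
    if "prism_cover (u, x) = prism_cover (v, y)" for u v x y
    using mod4[of u] mod4[of v] that by (elim disjE) (simp_all add: prism_cover_def)
  \<comment> \<open>Predecessor and successor of a vertex are two steps apart, hence incongruent
    modulo 4.\<close>
  have two: "w mod 4 \<noteq> v mod 4" if "v = Suc u mod n" "u = Suc w mod n" for u v w
    using mod4[of w] Suc4[of u] Suc4[of w] that by (elim disjE) simp_all
  show ?thesis
    unfolding locally_injective_hom_def
  proof (intro conjI allI impI)
    fix a b assume "adjacent (cycle_graph n \<box> complete_graph 2) a b"
    then show "adjacent (cube_graph 3) (prism_cover a) (prism_cover b)"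
      using up rung up[THEN adjacent_sym[THEN iffD1]] rung[THEN adjacent_sym[THEN iffD1]]
      by (cases a; cases b) (auto simp: adjacent_prism adjacent_cycle_graph)
  next
    fix a b c assume *: "adjacent (cycle_graph n \<box> complete_graph 2) b a"
      "adjacent (cycle_graph n \<box> complete_graph 2) b c" "prism_cover a = prism_cover c"
    obtain u x v y w z where abc: "a = (u, x)" "b = (v, y)" "c = (w, z)"
      by (metis surj_pair)
    have "u mod 4 = w mod 4" "x = 1 \<longleftrightarrow> z = 1"
      using *(3) fibre unfolding abc by blast+
    moreover have "x < 2" "z < 2"
      using *(1,2) by (auto simp: abc adjacent_cartesian_product adjacent_complete_graph)
    ultimately have "x = z" "u mod 4 = w mod 4"
      by auto
    moreover have "u = w" if "adjacent (cycle_graph n) v u" "adjacent (cycle_graph n) v w"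
      using that \<open>u mod 4 = w mod 4\<close> two Suc_mod_inj unfolding adjacent_cycle_graph by metis
    \<comment> \<open>Two cycle neighbours are settled just above, and two rung neighbours coincide.
      A cycle and a rung neighbour lie in different layers, contrary to
      \<open>x = z\<close>.\<close>
    ultimately show "a = c"
      using *(1,2) by (auto simp: abc adjacent_cartesian_product adjacent_complete_graph)
  qed (auto simp: prism_cover_def)
qed

lemma prism_orthogonal_etgcs:
  assumes "4 dvd n" "n \<ge> 3"
  shows "\<exists>c d. efficient_total_girth_coloring 3 (cycle_graph n \<box> complete_graph 2) c \<and>
    efficient_total_girth_coloring 3 (cycle_graph n \<box> complete_graph 2) d \<and>
    orthogonal_colorings (cycle_graph n \<box> complete_graph 2) c d"
proof -
  let ?G = "cycle_graph n \<box> complete_graph 2"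
  have n: "n \<ge> 2" "n > 0"
    using assms by auto
  have simple: "simple_graph ?G"
    by (intro simple_graph_cartesian_product simple_graph_cycle simple_graph_complete n)
  have connected: "connected_graph ?G"
    by (intro connected_graph_cartesian_product connected_graph_cycle connected_graph_complete n) simp
  have "regular_graph (2 + (2 - 1)) ?G"
    by (intro regular_graph_cartesian_product simple_graph_cycle regular_graph_cycle
        regular_graph_complete n assms)
  then have regular: "regular_graph 3 ?G"
    by simp
  \<comment> \<open>Two rungs and the two copies of one cycle edge form a 4-cycle, whatever the
    length of the cycle.\<close>
  have quad: "quadrilateral ?G (0, 0) (1, 0) (1, 1) (0, 1)"
    using assms(2)
    by (auto simp: quadrilateral_def adjacent_cartesian_product adjacent_cycle_graph
        adjacent_complete_graph)
  note cover = prism_cover_locally_injective_hom[OF assms(1)]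
  show ?thesis
    using pullback_etgc[OF simple connected regular quad cover cube_coloring_etgc]
      pullback_orthogonal[OF simple cover cube_colorings_orthogonal] by blast
qed

theorem theorem12:
  shows "(\<exists>c d. efficient_total_girth_coloring 3 (cube_graph 3) c \<and>
                efficient_total_girth_coloring 3 (cube_graph 3) d \<and>
                orthogonal_colorings (cube_graph 3) c d) \<and>
         (\<forall>j::int. j > 1 \<longrightarrow>
            (\<exists>c d. efficient_total_girth_coloring 3 (cycle_graph (nat (4 * j)) \<box> complete_graph 2) c \<and>
                   efficient_total_girth_coloring 3 (cycle_graph (nat (4 * j)) \<box> complete_graph 2) d \<and>
                   orthogonal_colorings (cycle_graph (nat (4 * j)) \<box> complete_graph 2) c d)) \<and>
         isomorphic (cube_graph 3 \<box> complete_graph 2) (cube_graph 4) \<and>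
         (\<forall>c d. efficient_total_girth_coloring 3 (cube_graph 3) c \<and>
                efficient_total_girth_coloring 3 (cube_graph 3) d \<and>
                orthogonal_colorings (cube_graph 3) c d \<longrightarrow>
                edge_girth_coloring 4 (cube_graph 3 \<box> complete_graph 2) (layered_edge_coloring c d)) \<and>
         (\<forall>j::int. j > 1 \<longrightarrow>
            (\<forall>c d. efficient_total_girth_coloring 3 (cycle_graph (nat (4 * j)) \<box> complete_graph 2) c \<and>
                   efficient_total_girth_coloring 3 (cycle_graph (nat (4 * j)) \<box> complete_graph 2) d \<and>
                   orthogonal_colorings (cycle_graph (nat (4 * j)) \<box> complete_graph 2) c d \<longrightarrow>
                   edge_girth_coloring 4 (cycle_graph (nat (4 * j)) \<box> complete_graph 2 \<box> complete_graph 2)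
                     (layered_edge_coloring c d)))"
proof (intro conjI allI impI)
  show "\<exists>c d. efficient_total_girth_coloring 3 (cube_graph 3) c \<and>
      efficient_total_girth_coloring 3 (cube_graph 3) d \<and> orthogonal_colorings (cube_graph 3) c d"
    using cube_coloring_etgc cube_colorings_orthogonal by blast
  show "isomorphic (cube_graph 3 \<box> complete_graph 2) (cube_graph 4)"
    using cube_graph_Suc_isomorphic[of 3] by simp
next
  fix j :: int assume "j > 1"
  then have "4 dvd nat (4 * j)" "nat (4 * j) \<ge> 3"
    by (simp_all add: nat_mult_distrib)
  then show "\<exists>c d.
      efficient_total_girth_coloring 3 (cycle_graph (nat (4 * j)) \<box> complete_graph 2) c \<and>
      efficient_total_girth_coloring 3 (cycle_graph (nat (4 * j)) \<box> complete_graph 2) d \<and>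
      orthogonal_colorings (cycle_graph (nat (4 * j)) \<box> complete_graph 2) c d"
    by (rule prism_orthogonal_etgcs)
qed (use layered_edge_girth_coloring in blast)+

end
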